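(* Let $d\ge1$ and $0<\alpha<1$. Let $m_0:[0,+\infty)\to\mathbb R$ be bounded, uniformly continuous, non-decreasing, not identically zero, with $m_0(0)=0$ and such that $(m_0)_\rho$ is compactly supported (i.e. $m_0$ is constant for large $\rho$). Let $M=\lim_{\rho\to\infty}m_0(\rho)$ and $$G_M(\kappa)=\int_{\omega_d|y|^d\le\kappa}F_M(|y|)\,dy,\qquad F_M(r)=\left(\alpha+\left(\frac{\omega_dr^d}{\alpha M}\right)^{\frac\alpha{1-\alpha}}\right)^{-\frac1\alpha}.$$ Then the unique bounded and uniformly continuous viscosity solution $m$ of $$\begin{cases}m_t+(m_\rho)_+^\alpha\,m=0,&t>0,\ \rho>0,\\ m(0,\rho)=m_0(\rho),\\ m(t,0)=0\end{cases}$$ satisfies, for all $\kappa_0>0$, $$\sup_{\kappa\ge\kappa_0}\left|\frac{m(t,t^{\frac1\alpha}\kappa)-G_M(\kappa)}{G_M(\kappa)}\right|\longrightarrow0\qquad\text{as }t\to+\infty.$$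
   Context: $s_+=\max(s,0)$; $\omega_d$ is the volume of the unit ball of $\mathbb R^d$. For continuous $f$ on $[0,\infty)^2$ and $X=(t,\rho)\in(0,\infty)^2$, $D^-f(X)=\{p\in\mathbb R^2:\liminf_{Y\to X}\frac{f(Y)-f(X)-p\cdot(Y-X)}{|Y-X|}\ge0\}$ and $D^+f(X)=\{p\in\mathbb R^2:\limsup_{Y\to X}\frac{f(Y)-f(X)-p\cdot(Y-X)}{|Y-X|}\le0\}$. A function $m\in\mathcal C([0,+\infty)^2)$ is a viscosity subsolution of the problem if $p_1+(p_2)_+^\alpha m(t,\rho)\le0$ for all $(t,\rho)\in(0,\infty)^2$ and all $(p_1,p_2)\in D^+m(t,\rho)$, and $m(0,\rho)\le m_0(\rho)$, $m(t,0)\le0$. It is a viscosity supersolution if $p_1+(p_2)_+^\alpha m(t,\rho)\ge0$ for all $(t,\rho)\in(0,\infty)^2$ and all $(p_1,p_2)\in D^-m(t,\rho)$, and $m(0,\rho)\ge m_0(\rho)$, $m(t,0)\ge0$. A viscosity solution is both. For such $m_0$ there is exactly one bounded and uniformly continuous viscosity solution. *)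

theory Defs
  imports "HOL-Analysis.Analysis"
begin

definition quadrant :: "(real \<times> real) set" where
  "quadrant = {0..} \<times> {0..}"

definition open_quadrant :: "(real \<times> real) set" where
  "open_quadrant = {0<..} \<times> {0<..}"

text \<open>
  Functions on the closed quadrant are total functions on pairs \<open>(t, \<rho>)\<close> whose values outside
  \<open>quadrant\<close> play no role; hence the lower and upper limits are taken within \<open>quadrant\<close>. They are
  taken in the extended reals, where they always exist.
\<close>

definition subdifferential :: "(real \<times> real \<Rightarrow> real) \<Rightarrow> real \<times> real \<Rightarrow> (real \<times> real) set" where
  "subdifferential f X =
    {p. Liminf (at X within quadrant)
          (\<lambda>Y. ereal ((f Y - f X - p \<bullet> (Y - X)) / norm (Y - X))) \<ge> 0}"

definition superdifferential :: "(real \<times> real \<Rightarrow> real) \<Rightarrow> real \<times> real \<Rightarrow> (real \<times> real) set" where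
  "superdifferential f X =
    {p. Limsup (at X within quadrant)
          (\<lambda>Y. ereal ((f Y - f X - p \<bullet> (Y - X)) / norm (Y - X))) \<le> 0}"

text \<open>
  Viscosity sub- and supersolutions of \<open>m\<^sub>t + (m\<^sub>\<rho>)\<^sub>+\<^sup>\<alpha> m = 0\<close> with initial datum \<open>m0\<close> and zero
  boundary datum.
\<close>

definition viscosity_subsolution ::
    "real \<Rightarrow> (real \<Rightarrow> real) \<Rightarrow> (real \<times> real \<Rightarrow> real) \<Rightarrow> bool" where
  "viscosity_subsolution \<alpha> m0 m \<longleftrightarrow>
     continuous_on quadrant m \<and>
     (\<forall>X\<in>open_quadrant. \<forall>(p1, p2)\<in>superdifferential m X.
        p1 + (max p2 0) powr \<alpha> * m X \<le> 0) \<and>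
     (\<forall>\<rho>\<ge>0. m (0, \<rho>) \<le> m0 \<rho>) \<and>
     (\<forall>t\<ge>0. m (t, 0) \<le> 0)"

definition viscosity_supersolution ::
    "real \<Rightarrow> (real \<Rightarrow> real) \<Rightarrow> (real \<times> real \<Rightarrow> real) \<Rightarrow> bool" where
  "viscosity_supersolution \<alpha> m0 m \<longleftrightarrow>
     continuous_on quadrant m \<and>
     (\<forall>X\<in>open_quadrant. \<forall>(p1, p2)\<in>subdifferential m X.
        p1 + (max p2 0) powr \<alpha> * m X \<ge> 0) \<and>
     (\<forall>\<rho>\<ge>0. m (0, \<rho>) \<ge> m0 \<rho>) \<and>
     (\<forall>t\<ge>0. m (t, 0) \<ge> 0)"

definition viscosity_solution ::
    "real \<Rightarrow> (real \<Rightarrow> real) \<Rightarrow> (real \<times> real \<Rightarrow> real) \<Rightarrow> bool" where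
  "viscosity_solution \<alpha> m0 m \<longleftrightarrow>
     viscosity_subsolution \<alpha> m0 m \<and> viscosity_supersolution \<alpha> m0 m"

text \<open>
  The space \<open>\<real>\<^sup>d\<close> is \<open>real ^ 'n\<close> with \<open>d = CARD('n) \<ge> 1\<close>; the dimension is passed as \<open>TYPE('n)\<close>.
\<close>

definition omega :: "'n::finite itself \<Rightarrow> real" where
  "omega _ = measure lborel (ball (0 :: real ^ 'n) 1)"

definition F_profile :: "'n::finite itself \<Rightarrow> real \<Rightarrow> real \<Rightarrow> real \<Rightarrow> real" where
  "F_profile T \<alpha> M r =
     (\<alpha> + (omega T * r ^ CARD('n) / (\<alpha> * M)) powr (\<alpha> / (1 - \<alpha>))) powr (- (1 / \<alpha>))"

definition G_profile :: "'n::finite itself \<Rightarrow> real \<Rightarrow> real \<Rightarrow> real \<Rightarrow> real" where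
  "G_profile T \<alpha> M \<kappa> =
     set_lebesgue_integral lborel {y :: real ^ 'n. omega T * norm y ^ CARD('n) \<le> \<kappa>}
       (\<lambda>y. F_profile T \<alpha> M (norm y))"

end

theory Submission
  imports Defs
begin

text \<open>
  If \<open>m0 = M\<close> on \<open>[R, \<infinity>)\<close>, comparison with translates of the classical self-similar solution
  \<open>u(t, \<rho>) = G\<^sub>M(\<rho> t\<^sup>-\<^sup>1\<^sup>/\<^sup>\<alpha>)\<close> gives \<open>u(t, \<rho> - R) \<le> m(t, \<rho>) \<le> u(t, \<rho>)\<close>; since one of the two
  functions compared is smooth, no doubling of variables is needed. Because \<open>G\<^sub>M(\<kappa>) / \<kappa>\<close> is
  nonincreasing, the relative error at \<open>\<kappa> \<ge> \<kappa>\<^sub>0\<close> is at most \<open>R t\<^sup>-\<^sup>1\<^sup>/\<^sup>\<alpha> / \<kappa>\<^sub>0\<close>.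
\<close>

section \<open>Smooth test functions and the one-sided differentials\<close>

lemma at_within_quadrant:
  assumes "X \<in> open_quadrant"
  shows "at X within quadrant = at X"
proof (rule at_within_open_subset)
  show "open open_quadrant"
    unfolding open_quadrant_def by (intro open_Times) auto
qed (use assms in \<open>auto simp: open_quadrant_def quadrant_def\<close>)

lemma difference_quotient_tendsto_0:
  fixes g :: "real \<times> real \<Rightarrow> real"
  assumes "(g has_derivative (\<lambda>h. p \<bullet> h)) (at X)"
  shows "((\<lambda>Y. ereal ((g Y - g X - p \<bullet> (Y - X)) / norm (Y - X))) \<longlongrightarrow> 0) (at X)"
proof -
  have "((\<lambda>Y. (g Y - g X - p \<bullet> (Y - X)) / norm (Y - X)) \<longlongrightarrow> 0) (at X)"
    using assms unfolding has_derivative_at_within by (simp add: divide_inverse mult.commute)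
  then show ?thesis
    by (simp add: zero_ereal_def)
qed

text \<open>A local maximum of \<open>f - g\<close> at \<open>X\<close> bounds the difference
  quotients of \<open>f\<close> by those of \<open>g\<close>, and the latter tend to 0 because
  \<open>p\<close> is the gradient of \<open>g\<close> at \<open>X\<close>.\<close>

lemma superdifferential_touching:
  fixes f g :: "real \<times> real \<Rightarrow> real"
  assumes "X \<in> open_quadrant"
    and "(g has_derivative (\<lambda>h. p \<bullet> h)) (at X)"
    and "\<forall>\<^sub>F Y in at X. f Y - g Y \<le> f X - g X"
  shows "p \<in> superdifferential f X"
proof -
  have "Limsup (at X) (\<lambda>Y. ereal ((f Y - f X - p \<bullet> (Y - X)) / norm (Y - X)))
      \<le> Limsup (at X) (\<lambda>Y. ereal ((g Y - g X - p \<bullet> (Y - X)) / norm (Y - X)))"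
    using assms(3) by (intro Limsup_mono) (auto elim!: eventually_mono intro!: divide_right_mono)
  also have "\<dots> = 0"
    by (intro lim_imp_Limsup difference_quotient_tendsto_0 assms) simp
  finally show ?thesis
    by (simp add: superdifferential_def at_within_quadrant assms(1))
qed

lemma subdifferential_touching:
  fixes f g :: "real \<times> real \<Rightarrow> real"
  assumes "X \<in> open_quadrant"
    and "(g has_derivative (\<lambda>h. p \<bullet> h)) (at X)"
    and "\<forall>\<^sub>F Y in at X. f Y - g Y \<ge> f X - g X"
  shows "p \<in> subdifferential f X"
proof -
  have "0 = Liminf (at X) (\<lambda>Y. ereal ((g Y - g X - p \<bullet> (Y - X)) / norm (Y - X)))"
    by (intro lim_imp_Liminf[symmetric] difference_quotient_tendsto_0 assms) simp
  also have "\<dots> \<le> Liminf (at X) (\<lambda>Y. ereal ((f Y - f X - p \<bullet> (Y - X)) / norm (Y - X)))"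
    using assms(3) by (intro Liminf_mono) (auto elim!: eventually_mono intro!: divide_right_mono)
  finally show ?thesis
    by (simp add: subdifferential_def at_within_quadrant assms(1))
qed

section \<open>Comparison with classical sub- and supersolutions\<close>

text \<open>The linear decay makes \<open>h\<close> nonpositive outside a compact rectangle, so a
  positive maximum over that rectangle is a global one.\<close>

lemma penalised_attains_positive_max:
  fixes h :: "real \<times> real \<Rightarrow> real"
  assumes cont: "continuous_on ({0..} \<times> {a..}) h"
    and bound: "\<And>t \<rho>. t \<ge> 0 \<Longrightarrow> \<rho> \<ge> a \<Longrightarrow> h (t, \<rho>) \<le> B - \<eta> * (t + \<rho>)"
    and "\<eta> > 0" and "t0 \<ge> 0" and "\<rho>0 \<ge> a" and pos: "h (t0, \<rho>0) > 0"
  shows "\<exists>t\<ge>0. \<exists>\<rho>\<ge>a. h (t, \<rho>) > 0 \<and> (\<forall>s\<ge>0. \<forall>r\<ge>a. h (s, r) \<le> h (t, \<rho>))"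
proof -
  \<comment> \<open>Outside the rectangle one coordinate exceeds \<open>c\<close>, while the other
    is at least 0 or \<open>a\<close>. The summand \<open>\<bar>a\<bar>\<close> absorbs a negative
    \<open>a\<close>, so \<open>s + r\<close> is still at least \<open>B / \<eta>\<close>.\<close>
  define c where "c = B / \<eta> + \<bar>a\<bar>"
  have large: "h (s, r) \<le> 0" if "s \<ge> 0" "r \<ge> a" "(s, r) \<notin> {0..c} \<times> {a..c}" for s r
  proof -
    have "B / \<eta> \<le> s + r"
      using that unfolding c_def by (auto simp: not_le)
    then have "B \<le> \<eta> * (s + r)"
      using \<open>\<eta> > 0\<close> by (simp add: field_simps)
    then show ?thesis
      using bound[OF that(1,2)] by simp
  qed
  then have X0: "(t0, \<rho>0) \<in> {0..c} \<times> {a..c}"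
    using assms by (meson not_le)
  have "continuous_on ({0..c} \<times> {a..c}) h"
    by (rule continuous_on_subset[OF cont]) auto
  moreover have "compact ({0..c} \<times> {a..c})"
    by (intro compact_Times) auto
  ultimately obtain X where X: "X \<in> {0..c} \<times> {a..c}" "\<And>Y. Y \<in> {0..c} \<times> {a..c} \<Longrightarrow> h Y \<le> h X"
    using continuous_attains_sup[of "{0..c} \<times> {a..c}" h] X0 by blast
  have "h X > 0"
    using X(2)[OF X0] pos by simp
  moreover have "h (s, r) \<le> h X" if "s \<ge> 0" "r \<ge> a" for s r
    using large[OF that] X(2)[of "(s, r)"] \<open>h X > 0\<close> by linarith
  ultimately show ?thesis
    using X(1) by (intro exI[of _ "fst X"] exI[of _ "snd X"] conjI) (auto simp: mem_Times_iff)
qed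

text \<open>Removes the perturbation parameters \<eta> and \<epsilon> from inequalities that are
  proved for all their positive values.\<close>

lemma nonneg_at_right_limit:
  fixes f :: "real \<Rightarrow> real"
  assumes "continuous_on {0..} f" and "\<And>\<epsilon>. \<epsilon> > 0 \<Longrightarrow> f \<epsilon> \<ge> 0"
  shows "f 0 \<ge> 0"
proof -
  have "(f \<longlongrightarrow> f 0) (at 0 within {0..})"
    using assms(1) by (simp add: continuous_on_def)
  then have "(f \<longlongrightarrow> f 0) (at_right 0)"
    by (rule tendsto_within_subset) auto
  moreover have "\<forall>\<^sub>F \<epsilon> in at_right 0. f \<epsilon> \<ge> 0"
    using eventually_at_right_less by eventually_elim (rule assms(2))
  ultimately show ?thesis
    by (rule tendsto_lowerbound) simp
qed

text \<open>
  Since \<open>p\<^sub>+\<^sup>\<alpha> m\<close> is nondecreasing in both \<open>p\<close> and \<open>m\<close>, adding \<open>\<eta> (t + \<rho>)\<close> to a classical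
  supersolution makes it strict and at the same time provides compactness at infinity.
\<close>

lemma viscosity_subsolution_le_classical:
  assumes "\<alpha> > 0"
    and sub: "viscosity_subsolution \<alpha> m0 m"
    and bound: "\<And>X. X \<in> quadrant \<Longrightarrow> m X \<le> B"
    and cont: "continuous_on quadrant w"
    and nonneg: "\<And>X. X \<in> quadrant \<Longrightarrow> w X \<ge> 0"
    and classical: "\<And>X. X \<in> open_quadrant \<Longrightarrow> \<exists>p1 p2. (w has_derivative (\<lambda>h. (p1, p2) \<bullet> h)) (at X) \<and>
      p2 \<ge> 0 \<and> p1 + p2 powr \<alpha> * w X \<ge> 0"
    and init: "\<And>\<rho>. \<rho> \<ge> 0 \<Longrightarrow> m0 \<rho> \<le> w (0, \<rho>)"
    and "t \<ge> 0" "\<rho> \<ge> 0"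
  shows "m (t, \<rho>) \<le> w (t, \<rho>)"
proof -
  have strict: "m (t0, \<rho>0) \<le> w (t0, \<rho>0) + \<eta> * (t0 + \<rho>0)"
    if par: "\<eta> > 0" "t0 \<ge> 0" "\<rho>0 \<ge> 0" for \<eta> t0 \<rho>0
  proof (rule ccontr)
    define g where "g = (\<lambda>X. w X + \<eta> * (fst X + snd X))"
    assume "\<not> ?thesis"
    then have pos: "m (t0, \<rho>0) - g (t0, \<rho>0) > 0"
      by (simp add: g_def)
    have diff_cont: "continuous_on ({0..} \<times> {0..}) (\<lambda>X. m X - g X)"
      using sub cont unfolding g_def viscosity_subsolution_def quadrant_def
      by (auto intro!: continuous_intros)
    have diff_le: "m (s, r) - g (s, r) \<le> B - \<eta> * (s + r)" if "s \<ge> 0" "r \<ge> 0" for s r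
      using bound[of "(s, r)"] nonneg[of "(s, r)"] that by (auto simp: quadrant_def g_def)
    obtain s r where sr: "s \<ge> 0" "r \<ge> 0" "m (s, r) - g (s, r) > 0"
      and max: "\<And>s' r'. s' \<ge> 0 \<Longrightarrow> r' \<ge> 0 \<Longrightarrow> m (s', r') - g (s', r') \<le> m (s, r) - g (s, r)"
      using penalised_attains_positive_max[OF diff_cont diff_le par pos] by metis
    have "\<eta> * (s + r) \<ge> 0"
      using sr \<open>\<eta> > 0\<close> by simp
    then have m_gt: "m (s, r) > w (s, r)" "w (s, r) \<ge> 0"
      using sr nonneg[of "(s, r)"] by (auto simp: quadrant_def g_def)
    \<comment> \<open>On both axes \<open>m\<close> is at most \<open>w\<close>, so the maximum
      point lies in the open quadrant, where the viscosity inequality is available.\<close>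
    have "m (0, r) \<le> m0 r" "m (s, 0) \<le> 0"
      using sub sr by (simp_all add: viscosity_subsolution_def)
    then have "m (0, r) \<le> w (0, r)" "m (s, 0) \<le> w (s, 0)"
      using init[of r] nonneg[of "(s, 0)"] sr by (simp_all add: quadrant_def)
    then have "s \<noteq> 0" "r \<noteq> 0"
      using m_gt by (metis not_less)+
    then have X: "(s, r) \<in> open_quadrant"
      using sr by (simp add: open_quadrant_def)
    then obtain p1 p2 where p: "(w has_derivative (\<lambda>h. (p1, p2) \<bullet> h)) (at (s, r))" "p2 \<ge> 0"
      "p1 + p2 powr \<alpha> * w (s, r) \<ge> 0"
      using classical by blast
    have "(g has_derivative (\<lambda>h. (p1 + \<eta>, p2 + \<eta>) \<bullet> h)) (at (s, r))"
      unfolding g_def by (auto intro!: derivative_eq_intros p(1) simp: algebra_simps inner_prod_def)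
    moreover have "\<forall>\<^sub>F Y in at (s, r). m Y - g Y \<le> m (s, r) - g (s, r)"
    proof -
      have "\<forall>\<^sub>F Y in at (s, r). Y \<in> open_quadrant"
        using X unfolding open_quadrant_def
        by (intro eventually_at_in_open' open_Times) auto
      then show ?thesis
        by eventually_elim (auto simp: open_quadrant_def intro!: max)
    qed
    ultimately have "(p1 + \<eta>, p2 + \<eta>) \<in> superdifferential m (s, r)"
      by (rule superdifferential_touching[OF X])
    then have "p1 + \<eta> + max (p2 + \<eta>) 0 powr \<alpha> * m (s, r) \<le> 0"
      using sub X unfolding viscosity_subsolution_def by blast
    \<comment> \<open>Both factors grow, since \<open>m > w \<ge> 0\<close> at the maximum and
      \<open>p2 \<ge> 0\<close>. The extra summand \<eta> in the time slope then contradicts the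
      classical inequality for \<open>w\<close>.\<close>
    moreover have "p2 powr \<alpha> * w (s, r) \<le> max (p2 + \<eta>) 0 powr \<alpha> * m (s, r)"
      using m_gt p(2) \<open>\<eta> > 0\<close> \<open>\<alpha> > 0\<close> by (intro mult_mono powr_mono2) auto
    ultimately show False
      using p(3) \<open>\<eta> > 0\<close> by linarith
  qed
  have "continuous_on {0..} (\<lambda>\<eta>. w (t, \<rho>) + \<eta> * (t + \<rho>) - m (t, \<rho>))"
    by (intro continuous_intros)
  from nonneg_at_right_limit[OF this] show ?thesis
    using strict[OF _ \<open>t \<ge> 0\<close> \<open>\<rho> \<ge> 0\<close>] by simp
qed

text \<open>The mirror image of the previous comparison, with the penalty subtracted. The domain
  starts at \<open>a\<close> because the lower barrier will be a translate that vanishes at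
  \<open>\<rho> = R\<close>. The slope \<open>p2 - \<eta>\<close> may be negative, but its positive
  part is still at most \<open>p2\<close>.\<close>

lemma classical_le_viscosity_supersolution:
  assumes "\<alpha> > 0" "a \<ge> 0"
    and super: "viscosity_supersolution \<alpha> m0 m"
    and bound: "\<And>t \<rho>. t \<ge> 0 \<Longrightarrow> \<rho> \<ge> a \<Longrightarrow> w (t, \<rho>) - m (t, \<rho>) \<le> B"
    and cont: "continuous_on ({0..} \<times> {a..}) w"
    and nonneg: "\<And>t \<rho>. t \<ge> 0 \<Longrightarrow> \<rho> \<ge> a \<Longrightarrow> w (t, \<rho>) \<ge> 0"
    and classical: "\<And>X. X \<in> {0<..} \<times> {a<..} \<Longrightarrow> \<exists>p1 p2. (w has_derivative (\<lambda>h. (p1, p2) \<bullet> h)) (at X) \<and>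
      p2 \<ge> 0 \<and> p1 + p2 powr \<alpha> * w X \<le> 0"
    and init: "\<And>\<rho>. \<rho> \<ge> a \<Longrightarrow> w (0, \<rho>) \<le> m0 \<rho>"
    and bdry: "\<And>t. t \<ge> 0 \<Longrightarrow> w (t, a) \<le> m (t, a)"
    and "t \<ge> 0" "\<rho> \<ge> a"
  shows "w (t, \<rho>) \<le> m (t, \<rho>)"
proof -
  have strict: "w (t0, \<rho>0) - \<eta> * (t0 + \<rho>0) \<le> m (t0, \<rho>0)"
    if par: "\<eta> > 0" "t0 \<ge> 0" "\<rho>0 \<ge> a" for \<eta> t0 \<rho>0
  proof (rule ccontr)
    define g where "g = (\<lambda>X. w X - \<eta> * (fst X + snd X))"
    assume "\<not> ?thesis"
    then have pos: "g (t0, \<rho>0) - m (t0, \<rho>0) > 0"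
      by (simp add: g_def)
    have "continuous_on ({0..} \<times> {a..}) m"
      using super \<open>a \<ge> 0\<close> unfolding viscosity_supersolution_def quadrant_def
      by (auto elim!: continuous_on_subset)
    then have diff_cont: "continuous_on ({0..} \<times> {a..}) (\<lambda>X. g X - m X)"
      using cont unfolding g_def by (auto intro!: continuous_intros)
    have diff_le: "g (s, r) - m (s, r) \<le> B - \<eta> * (s + r)" if "s \<ge> 0" "r \<ge> a" for s r
      using bound[of s r] that by (auto simp: g_def)
    obtain s r where sr: "s \<ge> 0" "r \<ge> a" "g (s, r) - m (s, r) > 0"
      and max: "\<And>s' r'. s' \<ge> 0 \<Longrightarrow> r' \<ge> a \<Longrightarrow> g (s', r') - m (s', r') \<le> g (s, r) - m (s, r)"
      using penalised_attains_positive_max[OF diff_cont diff_le par pos] by metis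
    have "\<eta> * (s + r) \<ge> 0"
      using sr \<open>\<eta> > 0\<close> \<open>a \<ge> 0\<close> by simp
    then have m_lt: "m (s, r) < w (s, r)" "w (s, r) \<ge> 0"
      using sr nonneg[of s r] by (auto simp: g_def)
    have "m0 r \<le> m (0, r)"
      using super sr \<open>a \<ge> 0\<close> by (simp add: viscosity_supersolution_def)
    then have "w (0, r) \<le> m (0, r)" "w (s, a) \<le> m (s, a)"
      using init[of r] bdry[of s] sr by simp_all
    then have "s \<noteq> 0" "r \<noteq> a"
      using m_lt by (metis not_less)+
    then have X': "(s, r) \<in> {0<..} \<times> {a<..}"
      using sr by simp
    then have X: "(s, r) \<in> open_quadrant"
      using \<open>a \<ge> 0\<close> by (simp add: open_quadrant_def)
    obtain p1 p2 where p: "(w has_derivative (\<lambda>h. (p1, p2) \<bullet> h)) (at (s, r))" "p2 \<ge> 0"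
      "p1 + p2 powr \<alpha> * w (s, r) \<le> 0"
      using classical[OF X'] by blast
    have "(g has_derivative (\<lambda>h. (p1 - \<eta>, p2 - \<eta>) \<bullet> h)) (at (s, r))"
      unfolding g_def by (auto intro!: derivative_eq_intros p(1) simp: algebra_simps inner_prod_def)
    moreover have "\<forall>\<^sub>F Y in at (s, r). m Y - g Y \<ge> m (s, r) - g (s, r)"
    proof -
      have "\<forall>\<^sub>F Y in at (s, r). Y \<in> {0<..} \<times> {a<..}"
        using X' by (intro eventually_at_in_open' open_Times) auto
      then show ?thesis
      proof eventually_elim
        case (elim Y)
        then show ?case
          using max[of "fst Y" "snd Y"] by (simp add: mem_Times_iff)
      qed
    qed
    ultimately have "(p1 - \<eta>, p2 - \<eta>) \<in> subdifferential m (s, r)"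
      by (rule subdifferential_touching[OF X])
    then have "p1 - \<eta> + max (p2 - \<eta>) 0 powr \<alpha> * m (s, r) \<ge> 0"
      using super X unfolding viscosity_supersolution_def by blast
    \<comment> \<open>The order matters: the sign of \<open>m\<close> is unknown, so
      \<open>m\<close> is first replaced by \<open>w\<close>, and only then does
      \<open>w \<ge> 0\<close> allow the slope to be increased to \<open>p2\<close>.\<close>
    moreover have "max (p2 - \<eta>) 0 powr \<alpha> * m (s, r) \<le> max (p2 - \<eta>) 0 powr \<alpha> * w (s, r)"
      using m_lt by (intro mult_left_mono) auto
    moreover have "max (p2 - \<eta>) 0 powr \<alpha> * w (s, r) \<le> p2 powr \<alpha> * w (s, r)"
      using m_lt p(2) \<open>\<eta> > 0\<close> \<open>\<alpha> > 0\<close> by (intro mult_right_mono powr_mono2) auto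
    ultimately show False
      using p(3) \<open>\<eta> > 0\<close> by linarith
  qed
  have "continuous_on {0..} (\<lambda>\<eta>. m (t, \<rho>) - (w (t, \<rho>) - \<eta> * (t + \<rho>)))"
    by (intro continuous_intros)
  from nonneg_at_right_limit[OF this] show ?thesis
    using strict[OF _ \<open>t \<ge> 0\<close> \<open>\<rho> \<ge> a\<close>] by simp
qed

section \<open>The explicit self-similar solution\<close>

text \<open>
  In mass coordinates the self-similar solution is explicit: \<open>v = m\<^sup>-\<^sup>\<beta>\<close> with \<open>\<beta> = \<alpha> / (1 - \<alpha>)\<close>
  solves \<open>v\<^sub>t = \<beta>\<^sup>1\<^sup>-\<^sup>\<alpha> (-v\<^sub>\<rho>)\<^sup>\<alpha>\<close>, whose Hopf--Lax formula gives
  \<open>m\<^sup>-\<^sup>\<beta> = M\<^sup>-\<^sup>\<beta> + (\<alpha> t)\<^sup>1\<^sup>+\<^sup>\<beta> \<rho>\<^sup>-\<^sup>\<beta>\<close>. The form below also covers \<open>\<rho> = 0 < t\<close>.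
\<close>

definition self_similar :: "real \<Rightarrow> real \<Rightarrow> real \<Rightarrow> real \<Rightarrow> real" where
  "self_similar \<alpha> M t \<rho> =
     M * \<rho> * (\<rho> powr (\<alpha> / (1 - \<alpha>)) + M powr (\<alpha> / (1 - \<alpha>)) * (\<alpha> * t) powr (1 / (1 - \<alpha>)))
       powr (- ((1 - \<alpha>) / \<alpha>))"

context
  fixes \<alpha> M :: real
  assumes \<alpha>: "0 < \<alpha>" "\<alpha> < 1" and M: "M > 0"
begin

definition \<beta> :: real where "\<beta> = \<alpha> / (1 - \<alpha>)"

lemma \<beta>_pos: "\<beta> > 0"
  using \<alpha> by (simp add: \<beta>_def)

lemma exponents: "1 / (1 - \<alpha>) = 1 + \<beta>" "(1 - \<alpha>) / \<alpha> = 1 / \<beta>" "\<alpha> * (1 + \<beta>) = \<beta>"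
  "1 / \<alpha> = 1 + 1 / \<beta>" "\<beta> / \<alpha> = 1 + \<beta>"
  using \<alpha> by (simp_all add: \<beta>_def field_simps)

text \<open>For \<open>\<rho> > 0\<close> this is \<open>(M * \<rho>) powr \<beta>\<close> times the
  Hopf--Lax expression for \<open>m\<^sup>-\<^sup>\<beta>\<close>; clearing the negative power of
  \<rho> keeps it finite at \<open>\<rho> = 0\<close>.\<close>

definition denom :: "real \<Rightarrow> real \<Rightarrow> real" where
  "denom t \<rho> = \<rho> powr \<beta> + M powr \<beta> * (\<alpha> * t) powr (1 + \<beta>)"

lemma denom_pos: "t \<ge> 0 \<Longrightarrow> \<rho> \<ge> 0 \<Longrightarrow> t > 0 \<or> \<rho> > 0 \<Longrightarrow> denom t \<rho> > 0"
  using \<alpha> M unfolding denom_def by (auto intro: add_pos_nonneg add_nonneg_pos)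

lemma self_similar_eq: "self_similar \<alpha> M t \<rho> = M * \<rho> * denom t \<rho> powr (- (1 / \<beta>))"
  by (simp only: self_similar_def denom_def exponents \<beta>_def[symmetric])

lemma self_similar_nonneg: "\<rho> \<ge> 0 \<Longrightarrow> self_similar \<alpha> M t \<rho> \<ge> 0"
  using M by (simp add: self_similar_eq)

lemma self_similar_pos: "t \<ge> 0 \<Longrightarrow> \<rho> > 0 \<Longrightarrow> self_similar \<alpha> M t \<rho> > 0"
  using M denom_pos[of t \<rho>] by (simp add: self_similar_eq)

lemma self_similar_initial: "\<rho> > 0 \<Longrightarrow> self_similar \<alpha> M 0 \<rho> = M"
  using \<beta>_pos by (simp add: self_similar_eq denom_def powr_powr powr_minus_divide)

text \<open>Dropping the nonnegative time term of \<open>denom\<close> can only increase its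
  negative power, and what remains is the initial value \<open>M\<close>.\<close>

lemma self_similar_le:
  assumes "t \<ge> 0" "\<rho> \<ge> 0"
  shows "self_similar \<alpha> M t \<rho> \<le> M"
proof (cases "\<rho> = 0")
  case False
  have "denom t \<rho> powr (- (1 / \<beta>)) \<le> (\<rho> powr \<beta>) powr (- (1 / \<beta>))"
    using False assms M \<beta>_pos by (intro powr_mono2') (auto simp: denom_def)
  also have "\<dots> = 1 / \<rho>"
    using False assms \<beta>_pos by (simp add: powr_powr powr_minus_divide)
  finally show ?thesis
    using False assms M by (simp add: self_similar_eq field_simps)
qed (use M in \<open>simp add: self_similar_eq\<close>)

text \<open>Since \<open>\<beta> / \<alpha> = 1 + \<beta>\<close>, both terms of
  \<open>denom\<close> scale by \<open>t powr (1 + \<beta>)\<close>; its power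
  \<open>- (1 / \<beta>)\<close> cancels the factor \<open>t powr (1 / \<alpha>)\<close> coming from
  \<rho>.\<close>

lemma self_similar_scaling:
  assumes "t > 0" "\<kappa> \<ge> 0"
  shows "self_similar \<alpha> M t (t powr (1 / \<alpha>) * \<kappa>) = self_similar \<alpha> M 1 \<kappa>"
proof -
  have "(1 / \<alpha>) * \<beta> = 1 + \<beta>"
    using exponents(5) by simp
  then have "denom t (t powr (1 / \<alpha>) * \<kappa>) = t powr (1 + \<beta>) * denom 1 \<kappa>"
    using assms \<alpha> by (simp add: denom_def powr_mult powr_powr algebra_simps)
  moreover have "(t powr (1 + \<beta>)) powr (- (1 / \<beta>)) = t powr (- (1 / \<alpha>))"
    using \<beta>_pos by (simp add: powr_powr exponents(4) field_simps)
  ultimately show ?thesis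
    using assms denom_pos[of 1 \<kappa>] by (simp add: self_similar_eq powr_mult powr_minus field_simps)
qed

text \<open>The quotient is \<open>M\<close> times a negative power of \<open>denom\<close>, which
  increases with \<rho>. This monotonicity turns the spatial shift by \<open>R\<close> into a
  relative error.\<close>

lemma self_similar_div_antimono:
  assumes "0 < \<rho>" "\<rho> \<le> \<rho>'" "t > 0"
  shows "self_similar \<alpha> M t \<rho>' / \<rho>' \<le> self_similar \<alpha> M t \<rho> / \<rho>"
proof -
  have "denom t \<rho>' powr (- (1 / \<beta>)) \<le> denom t \<rho> powr (- (1 / \<beta>))"
    using assms \<beta>_pos denom_pos[of t \<rho>] by (intro powr_mono2') (auto simp: denom_def intro!: powr_mono2)
  then show ?thesis
    using assms M by (simp add: self_similar_eq)
qed

text \<open>The origin has to be avoided: the function is \<open>M\<close> on the positive \<rho>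
  axis and 0 on the time axis. Allowing arbitrary arguments \<open>f\<close> and \<open>g\<close>
  covers the shifted barriers as well as the limits in \<epsilon>.\<close>

lemma continuous_on_self_similar:
  assumes "\<And>X. X \<in> S \<Longrightarrow> f X \<ge> 0 \<and> g X \<ge> 0 \<and> (f X > 0 \<or> g X > 0)"
    and "continuous_on S f" "continuous_on S g"
  shows "continuous_on S (\<lambda>X. self_similar \<alpha> M (f X) (g X))"
proof -
  have "denom (f X) (g X) \<noteq> 0" if "X \<in> S" for X
    using assms(1)[OF that] denom_pos[of "f X" "g X"] by auto
  then show ?thesis
    using assms \<alpha> \<beta>_pos unfolding self_similar_eq denom_def
    by (intro continuous_intros continuous_on_powr') auto
qed

definition self_similar_t :: "real \<Rightarrow> real \<Rightarrow> real" where
  "self_similar_t t \<rho> = - (M powr (1 + \<beta>) * \<rho> * denom t \<rho> powr (- (1 / \<alpha>)) * (\<alpha> * t) powr \<beta>)"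

text \<open>In the product rule the terms with \<open>\<rho> powr \<beta>\<close> cancel, which
  leaves only the time part of \<open>denom\<close> and makes the sign evident.\<close>

definition self_similar_\<rho> :: "real \<Rightarrow> real \<Rightarrow> real" where
  "self_similar_\<rho> t \<rho> = M powr (1 + \<beta>) * denom t \<rho> powr (- (1 / \<alpha>)) * (\<alpha> * t) powr (1 + \<beta>)"

lemma denom_has_derivative:
  assumes "t > 0" "\<rho> > 0"
  shows "((\<lambda>X. denom (fst X) (snd X)) has_derivative
    (\<lambda>h. \<beta> * \<rho> powr (\<beta> - 1) * snd h + M powr \<beta> * ((1 + \<beta>) * \<alpha> * (\<alpha> * t) powr \<beta>) * fst h)) (at (t, \<rho>))"
proof -
  have "((\<lambda>X. snd X powr \<beta>) has_derivative (\<lambda>h. snd h * (\<beta> * \<rho> powr (\<beta> - 1)))) (at (t, \<rho>))"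
    using assms by (intro DERIV_compose_FDERIV[where g = snd] bounded_linear_imp_has_derivative
      bounded_linear_snd) (auto intro!: has_real_derivative_powr)
  moreover have "((\<lambda>X. (\<alpha> * fst X) powr (1 + \<beta>)) has_derivative
      (\<lambda>h. (\<alpha> * fst h) * ((1 + \<beta>) * (\<alpha> * t) powr (1 + \<beta> - 1)))) (at (t, \<rho>))"
    using assms \<alpha> has_real_derivative_powr[of "\<alpha> * t" "1 + \<beta>"]
    by (intro DERIV_compose_FDERIV[where g = "\<lambda>X. \<alpha> * fst X"] bounded_linear_imp_has_derivative
      bounded_linear_const_mult bounded_linear_fst) auto
  ultimately have "((\<lambda>X. snd X powr \<beta> + M powr \<beta> * (\<alpha> * fst X) powr (1 + \<beta>)) has_derivative
      (\<lambda>h. snd h * (\<beta> * \<rho> powr (\<beta> - 1))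
         + M powr \<beta> * ((\<alpha> * fst h) * ((1 + \<beta>) * (\<alpha> * t) powr (1 + \<beta> - 1))))) (at (t, \<rho>))"
    by (intro has_derivative_add has_derivative_mult_right)
  then show ?thesis
    unfolding denom_def by (rule has_derivative_eq_rhs) (simp add: fun_eq_iff)
qed

lemma self_similar_has_derivative:
  assumes "t > 0" "\<rho> > 0"
  shows "((\<lambda>X. self_similar \<alpha> M (fst X) (snd X)) has_derivative
    (\<lambda>h. (self_similar_t t \<rho>, self_similar_\<rho> t \<rho>) \<bullet> h)) (at (t, \<rho>))"
proof -
  define E where "E = denom t \<rho> powr (- (1 / \<alpha>))"
  have Dpos: "denom t \<rho> > 0"
    using denom_pos[of t \<rho>] assms by simp
  have E: "denom t \<rho> powr (- (1 / \<beta>) - 1) = E"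
    unfolding E_def by (rule arg_cong[where f = "\<lambda>x. denom t \<rho> powr x"]) (simp add: exponents(4))
  have DE: "denom t \<rho> powr (- (1 / \<beta>)) = denom t \<rho> * E"
    using Dpos powr_add[of "denom t \<rho>" 1 "- (1 / \<beta>) - 1"] by (simp add: E)
  have \<rho>\<beta>: "\<rho> * \<rho> powr (\<beta> - 1) = \<rho> powr \<beta>"
    using assms by (simp add: powr_diff)
  have 1: "((\<lambda>X. denom (fst X) (snd X) powr (- (1 / \<beta>))) has_derivative
      (\<lambda>h. (\<beta> * \<rho> powr (\<beta> - 1) * snd h + M powr \<beta> * ((1 + \<beta>) * \<alpha> * (\<alpha> * t) powr \<beta>) * fst h)
        * (- (1 / \<beta>) * E))) (at (t, \<rho>))"
    using DERIV_compose_FDERIV[OF _ denom_has_derivative[OF assms], of "\<lambda>z. z powr (- (1 / \<beta>))" "- (1 / \<beta>) * E"]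
      has_real_derivative_powr[OF Dpos, of "- (1 / \<beta>)"] by (simp add: E)
  have 2: "((\<lambda>X. M * snd X) has_derivative (\<lambda>h. M * snd h)) (at (t, \<rho>))"
    by (intro bounded_linear_imp_has_derivative bounded_linear_const_mult bounded_linear_snd)
  have deriv: "((\<lambda>X. M * snd X * denom (fst X) (snd X) powr (- (1 / \<beta>))) has_derivative
      (\<lambda>h. M * \<rho> * ((\<beta> * \<rho> powr (\<beta> - 1) * snd h + M powr \<beta> * ((1 + \<beta>) * \<alpha> * (\<alpha> * t) powr \<beta>) * fst h)
        * (- (1 / \<beta>) * E)) + M * snd h * (denom t \<rho> * E))) (at (t, \<rho>))"
    using has_derivative_mult[OF 2 1] by (simp add: DE)
  have "M * \<rho> * ((\<beta> * \<rho> powr (\<beta> - 1) * y + M powr \<beta> * ((1 + \<beta>) * \<alpha> * (\<alpha> * t) powr \<beta>) * x)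
        * (- (1 / \<beta>) * E)) + M * y * (denom t \<rho> * E)
      = self_similar_t t \<rho> * x + self_similar_\<rho> t \<rho> * y" for x y
  proof -
    have c: "(1 + \<beta>) * \<alpha> * (1 / \<beta>) = 1"
      using exponents(3) \<beta>_pos by (simp add: mult.commute)
    \<comment> \<open>With the powers abstracted to variables this is a polynomial identity. It
      isolates the products \<open>\<beta> * i\<close>, \<open>\<rho> * P\<close> and
      \<open>(1 + \<beta>) * \<alpha> * i\<close>, which simplify for
      \<open>i = 1 / \<beta>\<close>.\<close>
    have ring: "M * \<rho> * ((\<beta> * P * y + Q * ((1 + \<beta>) * \<alpha> * T) * x) * (- i * E)) + M * y * (\<Delta> * E)
      = M * E * y * (\<Delta> - (\<beta> * i) * (\<rho> * P)) - M * Q * \<rho> * E * T * x * ((1 + \<beta>) * \<alpha> * i)"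
      for P Q T i \<Delta> :: real
      by (simp add: algebra_simps)
    have "M * \<rho> * ((\<beta> * \<rho> powr (\<beta> - 1) * y + M powr \<beta> * ((1 + \<beta>) * \<alpha> * (\<alpha> * t) powr \<beta>) * x)
        * (- (1 / \<beta>) * E)) + M * y * (denom t \<rho> * E)
      = M * E * y * (denom t \<rho> - (\<beta> * (1 / \<beta>)) * (\<rho> * \<rho> powr (\<beta> - 1)))
        - M * M powr \<beta> * \<rho> * E * (\<alpha> * t) powr \<beta> * x * ((1 + \<beta>) * \<alpha> * (1 / \<beta>))"
      by (rule ring)
    also have "\<dots> = M * E * y * (M powr \<beta> * (\<alpha> * t) powr (1 + \<beta>))
        - M * M powr \<beta> * \<rho> * E * (\<alpha> * t) powr \<beta> * x"
      using \<beta>_pos unfolding c \<rho>\<beta> by (simp add: denom_def)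
    also have "\<dots> = self_similar_t t \<rho> * x + self_similar_\<rho> t \<rho> * y"
      using M by (simp add: self_similar_t_def self_similar_\<rho>_def E_def powr_add algebra_simps)
    finally show ?thesis .
  qed
  then show ?thesis
    unfolding self_similar_eq by (intro has_derivative_eq_rhs[OF deriv]) (simp add: fun_eq_iff inner_prod_def)
qed

text \<open>By \<open>\<alpha> * (1 + \<beta>) = \<beta>\<close>, raising the slope to the power
  \<alpha> turns \<open>denom\<close> into its inverse. The factor
  \<open>denom powr (- (1 / \<beta>))\<close> of the solution completes this to the exponent
  \<open>- (1 / \<alpha>)\<close> of the time derivative.\<close>

lemma self_similar_equation:
  assumes "t > 0" "\<rho> > 0"
  shows "self_similar_t t \<rho> + self_similar_\<rho> t \<rho> powr \<alpha> * self_similar \<alpha> M t \<rho> = 0"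
proof -
  have "self_similar_\<rho> t \<rho> powr \<alpha> = M powr \<beta> * denom t \<rho> powr (- 1) * (\<alpha> * t) powr \<beta>"
    using assms \<alpha> M denom_pos[of t \<rho>] exponents(3)
    by (simp add: self_similar_\<rho>_def powr_mult powr_powr mult.commute)
  moreover have "denom t \<rho> powr (- (1 / \<alpha>)) = denom t \<rho> powr (- 1) * denom t \<rho> powr (- (1 / \<beta>))"
    by (subst powr_add[symmetric]) (simp add: exponents(4))
  ultimately show ?thesis
    using M by (simp add: self_similar_t_def self_similar_eq powr_add)
qed

text \<open>The equation is translation invariant. The upper barrier uses a shift \<epsilon> in
  space, the lower one a shift \<epsilon> in time and \<open>- R\<close> in space.\<close>

lemma self_similar_classical:
  assumes "t + a > 0" "\<rho> + b > 0"
  shows "\<exists>p1 p2. ((\<lambda>X. self_similar \<alpha> M (fst X + a) (snd X + b)) has_derivative (\<lambda>h. (p1, p2) \<bullet> h))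
      (at (t, \<rho>)) \<and> p2 \<ge> 0 \<and> p1 + p2 powr \<alpha> * self_similar \<alpha> M (t + a) (\<rho> + b) = 0"
proof -
  have "((\<lambda>X. X + (a, b)) has_derivative (\<lambda>h. h)) (at (t, \<rho>))"
    by (auto intro!: derivative_eq_intros)
  from has_derivative_compose[OF this, of "\<lambda>X. self_similar \<alpha> M (fst X) (snd X)"]
  have "((\<lambda>X. self_similar \<alpha> M (fst X + a) (snd X + b)) has_derivative
      (\<lambda>h. (self_similar_t (t + a) (\<rho> + b), self_similar_\<rho> (t + a) (\<rho> + b)) \<bullet> h)) (at (t, \<rho>))"
    using self_similar_has_derivative[OF assms] by simp
  moreover have "self_similar_\<rho> (t + a) (\<rho> + b) \<ge> 0"
    using M by (simp add: self_similar_\<rho>_def)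
  ultimately show ?thesis
    using self_similar_equation[OF assms] by blast
qed

section \<open>Upper and lower self-similar barriers\<close>

text \<open>Replacing \<rho> by \<open>\<rho> + \<epsilon>\<close> moves the discontinuity at the
  origin out of the quadrant and makes the initial value equal to \<open>M\<close> on all of
  \<open>\<rho> \<ge> 0\<close>.\<close>

lemma viscosity_subsolution_le_self_similar:
  assumes sub: "viscosity_subsolution \<alpha> m0 m"
    and bound: "\<And>X. X \<in> quadrant \<Longrightarrow> m X \<le> B"
    and init: "\<And>\<rho>. \<rho> \<ge> 0 \<Longrightarrow> m0 \<rho> \<le> M"
    and t\<rho>: "t > 0" "\<rho> \<ge> 0"
  shows "m (t, \<rho>) \<le> self_similar \<alpha> M t \<rho>"
proof -
  have shifted: "m (t, \<rho>) \<le> self_similar \<alpha> M t (\<rho> + \<epsilon>)" if "\<epsilon> > 0" for \<epsilon>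
  proof -
    define w where "w = (\<lambda>X. self_similar \<alpha> M (fst X + 0) (snd X + \<epsilon>))"
    have "m (t, \<rho>) \<le> w (t, \<rho>)"
    proof (rule viscosity_subsolution_le_classical[OF \<alpha>(1) sub bound])
      show "continuous_on quadrant w"
        unfolding w_def using that
        by (intro continuous_on_self_similar continuous_intros) (auto simp: quadrant_def)
      show "w X \<ge> 0" if "X \<in> quadrant" for X
        using that \<open>\<epsilon> > 0\<close> unfolding w_def by (intro self_similar_nonneg) (auto simp: quadrant_def)
      show "\<exists>p1 p2. (w has_derivative (\<lambda>h. (p1, p2) \<bullet> h)) (at X) \<and> p2 \<ge> 0 \<and> p1 + p2 powr \<alpha> * w X \<ge> 0"
        if "X \<in> open_quadrant" for X
        using that \<open>\<epsilon> > 0\<close> self_similar_classical[of "fst X" 0 "snd X" \<epsilon>]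
        by (force simp: open_quadrant_def w_def)
      show "m0 r \<le> w (0, r)" if "r \<ge> 0" for r
        using init[OF that] that \<open>\<epsilon> > 0\<close> by (simp add: w_def self_similar_initial)
    qed (use t\<rho> in auto)
    then show ?thesis
      by (simp add: w_def)
  qed
  have "continuous_on {0..} (\<lambda>\<epsilon>. self_similar \<alpha> M t (\<rho> + \<epsilon>) - m (t, \<rho>))"
    using t\<rho> by (intro continuous_on_self_similar continuous_intros) auto
  from nonneg_at_right_limit[OF this] show ?thesis
    using shifted by simp
qed

text \<open>The translated barrier vanishes at \<open>\<rho> = R\<close>, so
  \<open>m \<ge> 0\<close> settles that boundary; at time 0 it is at most \<open>M\<close>, the
  level that \<open>m0\<close> has reached beyond \<open>R\<close>. The time shift \<epsilon> makes
  the barrier continuous.\<close>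

lemma self_similar_le_viscosity_supersolution:
  assumes super: "viscosity_supersolution \<alpha> m0 m"
    and bound: "\<And>X. X \<in> quadrant \<Longrightarrow> - B \<le> m X"
    and init: "\<And>\<rho>. \<rho> \<ge> 0 \<Longrightarrow> 0 \<le> m0 \<rho>" "\<And>\<rho>. \<rho> \<ge> R \<Longrightarrow> M \<le> m0 \<rho>"
    and "R \<ge> 0" and t\<rho>: "t > 0" "\<rho> \<ge> R"
  shows "self_similar \<alpha> M t (\<rho> - R) \<le> m (t, \<rho>)"
proof -
  \<comment> \<open>Comparison with the zero solution on the whole quadrant.\<close>
  have nonneg: "0 \<le> m (s, r)" if "s \<ge> 0" "r \<ge> 0" for s r
  proof (rule classical_le_viscosity_supersolution[OF \<alpha>(1) order.refl super, where w = "\<lambda>_. 0"])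
    show "\<exists>p1 p2. ((\<lambda>_. 0) has_derivative (\<lambda>h. (p1, p2) \<bullet> h)) (at X) \<and> p2 \<ge> 0 \<and>
        p1 + p2 powr \<alpha> * 0 \<le> 0" for X :: "real \<times> real"
      by (intro exI[of _ 0]) (simp add: inner_prod_def)
    show "0 - m (s, r) \<le> B" if "s \<ge> 0" "r \<ge> 0" for s r
      using bound[of "(s, r)"] that by (simp add: quadrant_def)
    show "0 \<le> m (s, 0)" if "s \<ge> 0" for s
      using super that by (simp add: viscosity_supersolution_def)
  qed (use init that in auto)
  have shifted: "self_similar \<alpha> M (t + \<epsilon>) (\<rho> - R) \<le> m (t, \<rho>)" if "\<epsilon> > 0" for \<epsilon>
  proof -
    define w where "w = (\<lambda>X. self_similar \<alpha> M (fst X + \<epsilon>) (snd X + - R))"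
    have "w (t, \<rho>) \<le> m (t, \<rho>)"
    proof (rule classical_le_viscosity_supersolution[OF \<alpha>(1) \<open>R \<ge> 0\<close> super])
      show "continuous_on ({0..} \<times> {R..}) w"
        unfolding w_def using that by (intro continuous_on_self_similar continuous_intros) auto
      show w_nonneg: "w (s, r) \<ge> 0" if "s \<ge> 0" "r \<ge> R" for s r
        using that unfolding w_def by (intro self_similar_nonneg) auto
      have w_le: "w (s, r) \<le> M" if "s \<ge> 0" "r \<ge> R" for s r
        using that \<open>\<epsilon> > 0\<close> unfolding w_def by (intro self_similar_le) auto
      show "w (s, r) - m (s, r) \<le> M" if "s \<ge> 0" "r \<ge> R" for s r
        using w_le[OF that] nonneg[of s r] that \<open>R \<ge> 0\<close> by simp
      show "w (0, r) \<le> m0 r" if "r \<ge> R" for r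
        using w_le[of 0 r] init(2)[OF that] that by simp
      show "\<exists>p1 p2. (w has_derivative (\<lambda>h. (p1, p2) \<bullet> h)) (at X) \<and> p2 \<ge> 0 \<and> p1 + p2 powr \<alpha> * w X \<le> 0"
        if "X \<in> {0<..} \<times> {R<..}" for X
        using that \<open>\<epsilon> > 0\<close> self_similar_classical[of "fst X" \<epsilon> "snd X" "- R"]
        by (force simp: w_def)
      show "w (s, R) \<le> m (s, R)" if "s \<ge> 0" for s
        using nonneg[OF that \<open>R \<ge> 0\<close>] by (simp add: w_def self_similar_def)
    qed (use t\<rho> in auto)
    then show ?thesis
      by (simp add: w_def)
  qed
  have "continuous_on {0..} (\<lambda>\<epsilon>. m (t, \<rho>) - self_similar \<alpha> M (t + \<epsilon>) (\<rho> - R))"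
    using t\<rho> by (intro continuous_on_self_similar continuous_intros) auto
  from nonneg_at_right_limit[OF this] show ?thesis
    using shifted by simp
qed

section \<open>The profile integral in the mass coordinate\<close>

text \<open>The integrand is the \<rho> derivative of the self-similar solution at time 1, which
  vanishes at \<open>\<rho> = 0\<close>.\<close>

lemma self_similar_integral:
  assumes "\<kappa> \<ge> 0"
  shows "(\<integral>s\<in>{0..\<kappa>}. (\<alpha> + (s / (\<alpha> * M)) powr \<beta>) powr (- (1 / \<alpha>)) \<partial>lborel) = self_similar \<alpha> M 1 \<kappa>"
proof -
  define f where "f s = (\<alpha> + (s / (\<alpha> * M)) powr \<beta>) powr (- (1 / \<alpha>))" for s
  have f_eq: "f s = self_similar_\<rho> 1 s" if "s \<ge> 0" for s
  proof -
    \<comment> \<open>Because \<open>1 + \<beta> = \<beta> / \<alpha>\<close>, the prefactor can be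
      moved into the base of the power \<open>- (1 / \<alpha>)\<close>.\<close>
    have "M powr (1 + \<beta>) * \<alpha> powr (1 + \<beta>) = ((\<alpha> * M) powr \<beta>) powr (1 / \<alpha>)"
      using \<alpha> M exponents(5) by (simp add: powr_powr powr_mult)
    then have "self_similar_\<rho> 1 s = (denom 1 s / (\<alpha> * M) powr \<beta>) powr (- (1 / \<alpha>))"
      using \<alpha> M that denom_pos[of 1 s]
      by (simp add: self_similar_\<rho>_def powr_divide powr_minus field_simps)
    moreover have "denom 1 s / (\<alpha> * M) powr \<beta> = \<alpha> + (s / (\<alpha> * M)) powr \<beta>"
      using \<alpha> M that by (simp add: denom_def powr_divide powr_mult powr_add field_simps)
    ultimately show ?thesis
      by (simp add: f_def)
  qed
  have FTC: "(f has_integral self_similar \<alpha> M 1 \<kappa> - self_similar \<alpha> M 1 0) {0..\<kappa>}"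
  \<comment> \<open>The derivative has been computed only for \<open>\<rho> > 0\<close>; continuity
    suffices at the endpoints.\<close>
  proof (rule fundamental_theorem_of_calculus_interior[OF assms])
    show "continuous_on {0..\<kappa>} (self_similar \<alpha> M 1)"
      using continuous_on_self_similar[of "{0..\<kappa>}" "\<lambda>_. 1" "\<lambda>s. s"] by (auto intro: continuous_intros)
    show "(self_similar \<alpha> M 1 has_vector_derivative f s) (at s)" if "s \<in> {0<..<\<kappa>}" for s
    proof -
      have "((\<lambda>s. (1 :: real, s)) has_derivative (\<lambda>h. (0, h))) (at s)"
        by (auto intro!: derivative_eq_intros)
      from has_derivative_compose[OF this self_similar_has_derivative]
      show ?thesis
        using that by (simp add: has_vector_derivative_def f_eq inner_prod_def mult.commute)
    qed
  qed
  have "set_integrable lborel {0..\<kappa>} f"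
  proof (rule borel_integrable_atLeastAtMost')
    have "\<alpha> + (s / (\<alpha> * M)) powr \<beta> \<noteq> 0" for s
      using \<alpha> powr_ge_zero[of "s / (\<alpha> * M)" \<beta>] by linarith
    then show "continuous_on {0..\<kappa>} f"
      unfolding f_def using \<alpha> M \<beta>_pos by (intro continuous_intros continuous_on_powr') auto
  qed
  then have "(\<integral>s\<in>{0..\<kappa>}. f s \<partial>lborel) = self_similar \<alpha> M 1 \<kappa> - self_similar \<alpha> M 1 0"
    by (simp add: set_borel_integral_eq_integral(2) integral_unique[OF FTC])
  then show ?thesis
    by (simp add: f_def self_similar_def)
qed

end

lemma omega_eq: "omega TYPE('n::finite) = unit_ball_vol (real CARD('n))"
  by (simp add: omega_def content_ball)

lemma omega_pos: "omega TYPE('n::finite) > 0"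
  by (simp add: omega_eq)

lemma sublevel_eq_cball:
  assumes "s \<ge> 0"
  shows "{y :: real ^ 'n. omega TYPE('n::finite) * norm y ^ CARD('n) \<le> s}
    = cball 0 (root CARD('n) (s / omega TYPE('n)))"
proof -
  have "omega TYPE('n) * norm y ^ CARD('n) \<le> s \<longleftrightarrow> norm y \<le> root CARD('n) (s / omega TYPE('n))"
    for y :: "real ^ 'n"
  proof -
    have "omega TYPE('n) * norm y ^ CARD('n) \<le> s \<longleftrightarrow> norm y ^ CARD('n) \<le> s / omega TYPE('n)"
      using omega_pos[where 'n = 'n] by (simp add: field_simps)
    also have "\<dots> \<longleftrightarrow> root CARD('n) (norm y ^ CARD('n)) \<le> root CARD('n) (s / omega TYPE('n))"
      by simp
    finally show ?thesis
      by (simp add: real_root_power_cancel)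
  qed
  then show ?thesis
    by (intro set_eqI) (simp only: mem_Collect_eq mem_cball_0)
qed

text \<open>A ball of radius \<open>r\<close> has volume \<open>\<omega> r\<^sup>d\<close>, so the
  mass coordinate of a point is the volume of the centred ball reaching up to it.\<close>

lemma emeasure_sublevel:
  assumes "s \<ge> 0"
  shows "emeasure lborel {y :: real ^ 'n. omega TYPE('n::finite) * norm y ^ CARD('n) \<le> s} = ennreal s"
proof -
  define r where "r = root CARD('n) (s / omega TYPE('n))"
  have "r \<ge> 0" "omega TYPE('n) * r ^ CARD('n) = s"
    using assms omega_pos[where 'n = 'n] by (simp_all add: r_def)
  then show ?thesis
    unfolding sublevel_eq_cball[OF assms] r_def[symmetric]
    by (simp add: emeasure_cball omega_eq flip: ennreal_mult)
qed

text \<open>This takes the place of polar coordinates. Borel measures on the line that are finite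
  and equal on all half-lines \<open>{x<..}\<close> coincide; the cut-off at \<kappa> gives the
  finiteness.\<close>

lemma distr_mass_coordinate:
  fixes \<phi> :: "real ^ 'n::finite \<Rightarrow> real"
  assumes "\<kappa> \<ge> 0"
  defines "\<phi> \<equiv> \<lambda>y. omega TYPE('n) * norm y ^ CARD('n)"
  shows "distr (density lborel (indicator {y. \<phi> y \<le> \<kappa>})) borel \<phi> = density lborel (indicator {0..\<kappa>})"
    (is "?N = ?P")
proof (rule measure_eqI_lessThan)
  have \<phi>_measurable: "\<phi> \<in> borel_measurable borel"
    unfolding \<phi>_def by measurable
  have [measurable]: "{y. \<phi> y \<le> s} \<in> sets borel" "\<phi> -` {s<..} \<in> sets borel" for s
    using measurable_sets_borel[OF \<phi>_measurable, of "{..s}"]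
      measurable_sets_borel[OF \<phi>_measurable, of "{s<..}"] by (simp_all add: vimage_def)
  note \<phi>_measurable [measurable]
  have \<phi>_nonneg: "\<phi> y \<ge> 0" for y
    using omega_pos[where 'n = 'n] by (simp add: \<phi>_def)
  have vol: "emeasure lborel {y. \<phi> y \<le> s} = ennreal s" if "s \<ge> 0" for s
    using emeasure_sublevel[OF that, where 'n = 'n] by (simp add: \<phi>_def)
  have N: "emeasure ?N {x<..} = emeasure lborel {y. x < \<phi> y \<and> \<phi> y \<le> \<kappa>}" for x
  proof -
    have "emeasure ?N {x<..} = (\<integral>\<^sup>+y. indicator {y. \<phi> y \<le> \<kappa>} y * indicator (\<phi> -` {x<..}) y \<partial>lborel)"
      by (simp add: emeasure_distr emeasure_density)
    also have "\<dots> = (\<integral>\<^sup>+y. indicator {y. x < \<phi> y \<and> \<phi> y \<le> \<kappa>} y \<partial>lborel)"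
      by (intro nn_integral_cong) (auto split: split_indicator)
    finally show ?thesis
      by simp
  qed
  have P: "emeasure ?P {x<..} = emeasure lborel {s. x < s \<and> 0 \<le> s \<and> s \<le> \<kappa>}" for x
  proof -
    have "emeasure ?P {x<..} = (\<integral>\<^sup>+s. indicator {0..\<kappa>} s * indicator {x<..} s \<partial>lborel)"
      by (simp add: emeasure_density)
    also have "\<dots> = (\<integral>\<^sup>+s. indicator {s. x < s \<and> 0 \<le> s \<and> s \<le> \<kappa>} s \<partial>lborel)"
      by (intro nn_integral_cong) (auto split: split_indicator)
    finally show ?thesis
      by simp
  qed
  fix x :: real
  consider "x < 0" | "0 \<le> x" "x \<le> \<kappa>" | "x > \<kappa>"
    by linarith
  then have "emeasure ?N {x<..} = emeasure ?P {x<..} \<and> emeasure ?N {x<..} < \<infinity>"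
  proof cases
    case 1
    then have "{y. x < \<phi> y \<and> \<phi> y \<le> \<kappa>} = {y. \<phi> y \<le> \<kappa>}" "{s. x < s \<and> 0 \<le> s \<and> s \<le> \<kappa>} = {0..\<kappa>}"
      using \<phi>_nonneg by (auto intro: less_le_trans)
    then show ?thesis
      using \<open>\<kappa> \<ge> 0\<close> by (simp add: N P vol)
  next
    \<comment> \<open>The preimage is a shell between concentric balls of volumes \<open>x\<close>
      and \<kappa>.\<close>
    case 2
    then have *: "{y. x < \<phi> y \<and> \<phi> y \<le> \<kappa>} = {y. \<phi> y \<le> \<kappa>} - {y. \<phi> y \<le> x}"
      "{s. x < s \<and> 0 \<le> s \<and> s \<le> \<kappa>} = {x<..\<kappa>}"
      by auto
    have "emeasure lborel ({y. \<phi> y \<le> \<kappa>} - {y. \<phi> y \<le> x}) = ennreal (\<kappa> - x)"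
      using 2 by (subst emeasure_Diff) (auto simp: vol ennreal_minus)
    then show ?thesis
      using 2 by (simp add: N P *)
  next
    case 3
    then have *: "{y. x < \<phi> y \<and> \<phi> y \<le> \<kappa>} = {}" "{s. x < s \<and> 0 \<le> s \<and> s \<le> \<kappa>} = {}"
      by auto
    show ?thesis
      unfolding N P * by simp
  qed
  then show "emeasure ?N {x<..} = emeasure ?P {x<..}" "emeasure ?N {x<..} < \<infinity>"
    by auto
qed simp_all

text \<open>The integrand depends on \<open>y\<close> only through \<phi>, so the integral is
  transported to the line; set integrals are written as densities so that the transformation formula
  for image measures applies.\<close>

lemma G_profile_eq:
  assumes "0 < \<alpha>" "\<alpha> < 1" "M > 0" "\<kappa> \<ge> 0"
  shows "G_profile TYPE('n::finite) \<alpha> M \<kappa> = self_similar \<alpha> M 1 \<kappa>"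
proof -
  define \<phi> :: "real ^ 'n \<Rightarrow> real" where "\<phi> = (\<lambda>y. omega TYPE('n) * norm y ^ CARD('n))"
  define f where "f = (\<lambda>s. (\<alpha> + (s / (\<alpha> * M)) powr (\<alpha> / (1 - \<alpha>))) powr (- (1 / \<alpha>)))"
  have [measurable]: "\<phi> \<in> borel_measurable borel" "f \<in> borel_measurable borel"
    unfolding \<phi>_def f_def by measurable
  have "G_profile TYPE('n) \<alpha> M \<kappa> = (\<integral>y. indicator {y. \<phi> y \<le> \<kappa>} y *\<^sub>R f (\<phi> y) \<partial>lborel)"
    by (simp add: G_profile_def F_profile_def set_lebesgue_integral_def f_def \<phi>_def)
  also have "\<dots> = (\<integral>y. f (\<phi> y) \<partial>density lborel (\<lambda>y. ennreal (indicator {y. \<phi> y \<le> \<kappa>} y)))"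
    by (subst integral_density) auto
  also have "\<dots> = (\<integral>s. f s \<partial>distr (density lborel (indicator {y. \<phi> y \<le> \<kappa>})) borel \<phi>)"
    by (subst integral_distr) (auto simp: ennreal_indicator)
  also have "\<dots> = (\<integral>s. f s \<partial>density lborel (\<lambda>s. ennreal (indicator {0..\<kappa>} s)))"
    using distr_mass_coordinate[OF assms(4), where 'n = 'n] by (simp add: \<phi>_def ennreal_indicator)
  also have "\<dots> = (\<integral>s\<in>{0..\<kappa>}. f s \<partial>lborel)"
    unfolding set_lebesgue_integral_def by (subst integral_density) auto
  also have "\<dots> = self_similar \<alpha> M 1 \<kappa>"
    using self_similar_integral[OF assms] by (simp add: f_def \<beta>_def[OF assms(1-3)])
  finally show ?thesis .
qed

section \<open>Decay of the relative error\<close>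

theorem theorem7p17:
  fixes \<alpha> M \<kappa>0 :: real
    and m0 :: "real \<Rightarrow> real"
    and m :: "real \<times> real \<Rightarrow> real"
  assumes "0 < \<alpha>" and "\<alpha> < 1"
    and "bounded (m0 ` {0..})"
    and "uniformly_continuous_on {0..} m0"
    and "mono_on {0..} m0"
    and "\<exists>\<rho>\<ge>0. m0 \<rho> \<noteq> 0"
    and "m0 0 = 0"
    and "\<exists>R\<ge>0. \<forall>\<rho>\<ge>R. m0 \<rho> = m0 R"
    and "(m0 \<longlongrightarrow> M) at_top"
    and "bounded (m ` quadrant)"
    and "uniformly_continuous_on quadrant m"
    and "viscosity_solution \<alpha> m0 m"
    and "\<kappa>0 > 0"
  shows "((\<lambda>t. SUP \<kappa>\<in>{\<kappa>0..}.
            ereal \<bar>(m (t, t powr (1 / \<alpha>) * \<kappa>) - G_profile TYPE('n::finite) \<alpha> M \<kappa>)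
                     / G_profile TYPE('n) \<alpha> M \<kappa>\<bar>) \<longlongrightarrow> 0) at_top"
proof -
  from assms(8) obtain R where "R \<ge> 0 \<and> (\<forall>\<rho>\<ge>R. m0 \<rho> = m0 R)" ..
  then have R: "R \<ge> 0" "\<And>\<rho>. \<rho> \<ge> R \<Longrightarrow> m0 \<rho> = m0 R"
    by (rule conjunct1, elim conjE allE impE)
  have "\<forall>\<^sub>F \<rho> in at_top. m0 \<rho> = m0 R"
    using eventually_ge_at_top[of R] by eventually_elim (rule R(2))
  then have "(m0 \<longlongrightarrow> m0 R) at_top"
    by (rule tendsto_eventually)
  then have M: "m0 R = M"
    using assms(9) by (intro tendsto_unique) auto
  have m0_bounds: "0 \<le> m0 \<rho>" "m0 \<rho> \<le> M" if "\<rho> \<ge> 0" for \<rho>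
  proof -
    show "0 \<le> m0 \<rho>"
      using mono_onD[OF assms(5), of 0 \<rho>] that assms(7) by simp
    \<comment> \<open>Passing to \<open>max \<rho> R\<close> reaches the range where
      \<open>m0\<close> equals \<open>M\<close>.\<close>
    have "m0 \<rho> \<le> m0 (max \<rho> R)"
      using mono_onD[OF assms(5), of \<rho> "max \<rho> R"] that by simp
    then show "m0 \<rho> \<le> M"
      using R(2)[of "max \<rho> R"] M by simp
  qed
  obtain \<rho>1 where "\<rho>1 \<ge> 0" "m0 \<rho>1 \<noteq> 0"
    using assms(6) by blast
  then have "M > 0"
    using m0_bounds[of \<rho>1] by linarith
  note profile = \<open>0 < \<alpha>\<close> \<open>\<alpha> < 1\<close> \<open>M > 0\<close>
  obtain B where B: "\<bar>m X\<bar> \<le> B" if "X \<in> quadrant" for X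
    using assms(10) unfolding bounded_iff by auto
  have upper: "m (t, \<rho>) \<le> self_similar \<alpha> M t \<rho>" if "t > 0" "\<rho> \<ge> 0" for t \<rho>
    using assms(12) B m0_bounds that unfolding viscosity_solution_def
    by (intro viscosity_subsolution_le_self_similar[OF profile, of m0 m B]) (auto simp: abs_le_iff)
  have lower: "self_similar \<alpha> M t (\<rho> - R) \<le> m (t, \<rho>)" if "t > 0" "\<rho> \<ge> R" for t \<rho>
  proof (rule self_similar_le_viscosity_supersolution[OF profile, of m0 m B])
    show "- B \<le> m X" if "X \<in> quadrant" for X
      using B[OF that] by linarith
    show "M \<le> m0 r" if "r \<ge> R" for r
      using R(2)[OF that] M by simp
  qed (use assms(12) m0_bounds(1) R(1) that in \<open>auto simp: viscosity_solution_def\<close>)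
  \<comment> \<open>The bound does not involve \<kappa>, which gives uniformity; the condition on
    \<open>t\<close> places every point with \<open>\<kappa> \<ge> \<kappa>0\<close> beyond
    \<open>R\<close>.\<close>
  have close: "\<bar>(m (t, t powr (1 / \<alpha>) * \<kappa>) - G_profile TYPE('n) \<alpha> M \<kappa>) / G_profile TYPE('n) \<alpha> M \<kappa>\<bar>
      \<le> R / \<kappa>0 * t powr (- (1 / \<alpha>))"
    if t: "t > 0" "t powr (1 / \<alpha>) * \<kappa>0 > R" and "\<kappa> \<ge> \<kappa>0" for t \<kappa>
  proof -
    define \<rho> where "\<rho> = t powr (1 / \<alpha>) * \<kappa>"
    define G where "G = self_similar \<alpha> M t \<rho>"
    have \<rho>: "t powr (1 / \<alpha>) * \<kappa>0 \<le> \<rho>" "\<rho> > R"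
      using that by (auto simp: \<rho>_def intro: less_le_trans mult_left_mono)
    then have "\<rho> > 0"
      using R(1) by simp
    have G_eq: "G_profile TYPE('n) \<alpha> M \<kappa> = G"
      using G_profile_eq[OF profile, of \<kappa>] self_similar_scaling[OF profile, of t \<kappa>] that \<open>\<kappa>0 > 0\<close>
      by (simp add: G_def \<rho>_def)
    have "G > 0"
      using self_similar_pos[OF profile, of t \<rho>] \<open>\<rho> > 0\<close> t by (simp add: G_def)
    \<comment> \<open>With the lower barrier this yields
      \<open>m \<ge> G * (1 - R / \<rho>)\<close>.\<close>
    have "G / \<rho> \<le> self_similar \<alpha> M t (\<rho> - R) / (\<rho> - R)"
      using self_similar_div_antimono[OF profile, of "\<rho> - R" \<rho> t] \<rho> R(1) t by (simp add: G_def)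
    then have "G / \<rho> * (\<rho> - R) \<le> self_similar \<alpha> M t (\<rho> - R)"
      using \<rho> by (simp add: pos_le_divide_eq)
    also have "\<dots> \<le> m (t, \<rho>)"
      using lower t \<rho> by simp
    finally have "(G - m (t, \<rho>)) / G \<le> R / \<rho>"
      using \<open>G > 0\<close> \<open>\<rho> > 0\<close> by (simp add: field_simps)
    also have "\<dots> \<le> R / (t powr (1 / \<alpha>) * \<kappa>0)"
      using \<rho> R(1) t \<open>\<kappa>0 > 0\<close> by (intro divide_left_mono) auto
    also have "\<dots> = R / \<kappa>0 * t powr (- (1 / \<alpha>))"
      by (simp add: powr_minus_divide)
    finally have "(G - m (t, \<rho>)) / G \<le> R / \<kappa>0 * t powr (- (1 / \<alpha>))" .
    \<comment> \<open>The upper barrier fixes the sign, so the one-sided estimate is already the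
      full relative error.\<close>
    moreover have "\<bar>(m (t, \<rho>) - G) / G\<bar> = (G - m (t, \<rho>)) / G"
      using upper[of t \<rho>] \<open>G > 0\<close> \<open>\<rho> > 0\<close> t by (simp add: G_def abs_div_pos)
    ultimately show ?thesis
      unfolding G_eq \<rho>_def[symmetric] by simp
  qed
  have "\<forall>\<^sub>F t in at_top. t powr (1 / \<alpha>) * \<kappa>0 > R"
    using eventually_gt_at_top[of "(R / \<kappa>0) powr \<alpha>"]
  proof eventually_elim
    case (elim t)
    then have "((R / \<kappa>0) powr \<alpha>) powr (1 / \<alpha>) < t powr (1 / \<alpha>)"
      using \<open>0 < \<alpha>\<close> by (intro powr_less_mono2) auto
    then show ?case
      using \<open>0 < \<alpha>\<close> \<open>\<kappa>0 > 0\<close> R(1) by (simp add: powr_powr field_simps)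
  qed
  then have le: "\<forall>\<^sub>F t in at_top. (SUP \<kappa>\<in>{\<kappa>0..}.
      ereal \<bar>(m (t, t powr (1 / \<alpha>) * \<kappa>) - G_profile TYPE('n) \<alpha> M \<kappa>) / G_profile TYPE('n) \<alpha> M \<kappa>\<bar>)
      \<le> ereal (R / \<kappa>0 * t powr (- (1 / \<alpha>)))"
    using eventually_gt_at_top[of 0] by eventually_elim (intro SUP_least, simp only: ereal_less_eq atLeast_iff close)
  \<comment> \<open>In the extended reals an empty supremum would be minus infinity; the index
    \<open>\<kappa>0\<close> supplies a nonnegative term.\<close>
  have ge: "\<forall>\<^sub>F t in at_top. 0 \<le> (SUP \<kappa>\<in>{\<kappa>0..}.
      ereal \<bar>(m (t, t powr (1 / \<alpha>) * \<kappa>) - G_profile TYPE('n) \<alpha> M \<kappa>) / G_profile TYPE('n) \<alpha> M \<kappa>\<bar>)"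
    by (intro always_eventually allI SUP_upper2[of \<kappa>0]) auto
  have "((\<lambda>t. ereal (R / \<kappa>0 * t powr (- (1 / \<alpha>)))) \<longlongrightarrow> ereal (R / \<kappa>0 * 0)) at_top"
    using \<open>0 < \<alpha>\<close> by (intro tendsto_ereal tendsto_mult_left tendsto_neg_powr filterlim_ident) auto
  then have "((\<lambda>t. ereal (R / \<kappa>0 * t powr (- (1 / \<alpha>)))) \<longlongrightarrow> 0) at_top"
    by (simp only: mult_zero_right zero_ereal_def)
  from tendsto_sandwich[OF ge le tendsto_const this] show ?thesis .
qed

end
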